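(* Let $C>0$, let $r\ge 3$ be an integer and let $\alpha\in\left(\frac{2}{r},1\right]$ be a real number. Let $G$ be a graph with $m$ edges and suppose $k_r(G)\ge C m^{\frac{\alpha r}{2}}$. Then there exists a subgraph $G_0\subseteq G$ of order $n_0\ge C_1 m^{\frac{\alpha}{2}}$ such that for every $i=2,\ldots,r$, $$k_i(G_0)\ge C_i\, n_0^{\frac{i(r-2)\alpha}{(2-\alpha)r-2}},$$ where the constants $C_1,C_2,\ldots,C_r>0$ depend only on $C$, $r$ and $\alpha$.
   Context: All graphs are finite and simple. For a graph $G$, $k_i(G)$ denotes the number of copies of the complete graph $K_i$ in $G$ (so $k_2(G)$ is the number of edges). The order of a graph is its number of vertices. *)

theory Defs
  imports Complex_Main "Graph_Theory.Graph_Theory"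
begin

text \<open>
  A finite simple graph is a \<^const>\<open>pair_graph\<close>: each undirected edge
  \<open>{u, v}\<close> is represented by the two arcs \<open>(u, v)\<close> and \<open>(v, u)\<close>.
\<close>

definition uedges :: "'a pair_pre_digraph \<Rightarrow> 'a set set" where
  "uedges G = {{u, v} |u v. (u, v) \<in> parcs G}"

definition clique_count :: "nat \<Rightarrow> 'a pair_pre_digraph \<Rightarrow> nat" where
  "clique_count i G = card {H :: 'a pair_pre_digraph. subgraph H G \<and> K\<^bsub>i\<^esub> H}"

lemma clique_count_2:
  assumes "pair_graph G"
  shows "clique_count 2 G = card (uedges G)"
proof -
  interpret pair_graph G by fact
  let ?S = "{H :: 'a pair_pre_digraph. subgraph H G \<and> K\<^bsub>2\<^esub> H}"
  have inj: "inj_on pverts ?S"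
  proof (rule inj_onI)
    fix H H' :: "'a pair_pre_digraph"
    assume *: "H \<in> ?S" "H' \<in> ?S" "pverts H = pverts H'"
    have "K\<^bsub>2\<^esub> H" "K\<^bsub>2\<^esub> H'" using * by blast+
    then have "parcs H = parcs H'" by (simp add: complete_digraph_pair_def *(3))
    with *(3) show "H = H'" by simp
  qed
  have "pverts ` ?S = uedges G"
  proof (intro set_eqI iffI)
    fix e assume "e \<in> pverts ` ?S"
    then obtain H :: "'a pair_pre_digraph" where H: "subgraph H G" "K\<^bsub>2\<^esub> H" "e = pverts H"
      by auto
    then have "card e = 2" by (simp add: complete_digraph_pair_def)
    then obtain u v where e: "e = {u, v}" "u \<noteq> v" by (auto simp: card_2_iff)
    then have "(u, v) \<in> parcs H" using H by (auto simp: complete_digraph_pair_def)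
    then have "(u, v) \<in> parcs G" using H(1) by (auto simp: subgraph_def)
    then show "e \<in> uedges G" using e by (auto simp: uedges_def)
  next
    fix e assume "e \<in> uedges G"
    then obtain u v where e: "e = {u, v}" "(u, v) \<in> parcs G" by (auto simp: uedges_def)
    have uv: "u \<noteq> v" using pair_no_loops[OF e(2)] by simp
    have vu: "(v, u) \<in> parcs G" using pair_sym_arcs e(2) by (auto simp: symmetric_def sym_def)
    define H :: "'a pair_pre_digraph" where "H = \<lparr>pverts = {u, v}, parcs = {(u, v), (v, u)}\<rparr>"
    have "K\<^bsub>2\<^esub> H" using uv by (auto simp: complete_digraph_pair_def H_def)
    moreover have "wf_digraph (with_proj H)" by (auto simp: H_def wf_digraph_def)
    then have "subgraph H G"
      using e(2) vu in_arcsD1 in_arcsD2 wf_digraph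
      by (auto simp: subgraph_def H_def compatible_def)
    ultimately have "H \<in> ?S" by blast
    moreover have "e = pverts H" using e(1) by (simp add: H_def)
    ultimately show "e \<in> pverts ` ?S" by (rule rev_image_eqI)
  qed
  then show ?thesis using card_image[OF inj] by (simp add: clique_count_def)
qed

end

theory Submission
  imports Defs
begin

text \<open>
  Delete all vertices whose degree is less than \<open>d = \<epsilon> m\<^sup>t\<close> with
  \<open>t = (\<alpha> r - 2) / (2 (r - 2))\<close>. A vertex of degree \<open>\<delta>\<close> lies in at most \<open>\<delta>\<^sup>r\<^sup>-\<^sup>1\<close> copies
  of \<open>K\<^sub>r\<close>, so the deletion destroys at most \<open>2 m d\<^sup>r\<^sup>-\<^sup>2 = 2 \<epsilon>\<^sup>r\<^sup>-\<^sup>2 m\<^bsup>\<alpha>r/2\<^esup>\<close> copies, which is at most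
  half of them if \<open>\<epsilon>\<close> is small, while at most \<open>2 m / d\<close> vertices remain.
  The weak form \<open>k\<^sub>r\<^sup>i \<le> k\<^sub>i\<^sup>r\<close> of the Kruskal--Katona theorem turns the lower bound on
  \<open>k\<^sub>r(G\<^sub>0)\<close> into lower bounds on all \<open>k\<^sub>i(G\<^sub>0)\<close>, including \<open>k\<^sub>1(G\<^sub>0) = n\<^sub>0\<close>.
  It is proved for simplicial complexes by induction, bounding the number of \<open>j\<close>-faces of a vertex
  link by the geometric mean of the inductive bound and the total number of \<open>j\<close>-faces.
\<close>

section \<open>Simplicial complexes and a weak Kruskal-Katona inequality\<close>

definition face_count :: "nat \<Rightarrow> 'a set set \<Rightarrow> nat" where
  "face_count j F = card {A \<in> F. card A = j}"

definition link :: "'a \<Rightarrow> 'a set set \<Rightarrow> 'a set set" where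
  "link v F = {A. v \<notin> A \<and> insert v A \<in> F}"

text \<open>The empty face is included so that \<open>face_count 0 F\<close> is 1, which starts the
  induction on face sizes. A finite vertex set makes the complex and all its faces finite.\<close>

definition simplicial_complex :: "'a set set \<Rightarrow> bool" where
  "simplicial_complex F \<longleftrightarrow> {} \<in> F \<and> finite (\<Union>F) \<and> (\<forall>A\<in>F. \<forall>B. B \<subseteq> A \<longrightarrow> B \<in> F)"

lemma simplicial_complex_finite:
  assumes "simplicial_complex F"
  shows "finite F" and "A \<in> F \<Longrightarrow> finite A"
proof -
  have "finite (\<Union>F)" using assms by (simp add: simplicial_complex_def)
  then show "finite F" by (rule finite_UnionD)
  show "A \<in> F \<Longrightarrow> finite A"
    using \<open>finite (\<Union>F)\<close> by (meson Union_upper finite_subset)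
qed

lemma link_subset:
  assumes "simplicial_complex F"
  shows "link v F \<subseteq> F"
  using assms unfolding simplicial_complex_def link_def by blast

text \<open>Since \<open>v\<close> is a vertex, \<open>{v}\<close> is a face, and this puts the
  empty face into the link.\<close>

lemma simplicial_complex_link:
  assumes "simplicial_complex F" and "v \<in> \<Union>F"
  shows "simplicial_complex (link v F)"
  unfolding simplicial_complex_def
proof (intro conjI ballI allI impI)
  show "{} \<in> link v F"
    using assms unfolding simplicial_complex_def link_def by blast
  show "finite (\<Union>(link v F))"
    using link_subset[OF assms(1)] assms(1) unfolding simplicial_complex_def
    by (meson Union_mono finite_subset)
  fix A B assume "A \<in> link v F" "B \<subseteq> A"
  then have "insert v B \<subseteq> insert v A" "insert v A \<in> F" "v \<notin> B"
    by (auto simp: link_def)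
  then show "B \<in> link v F"
    using assms(1) unfolding simplicial_complex_def link_def by blast
qed

text \<open>Inserting \<open>v\<close> is a bijection from the \<open>j\<close>-element faces of the
  link onto the faces of size \<open>Suc j\<close> through \<open>v\<close>.\<close>

lemma face_count_link:
  assumes "simplicial_complex F"
  shows "face_count j (link v F) = card {A \<in> F. card A = Suc j \<and> v \<in> A}"
proof -
  let ?S = "{A \<in> link v F. card A = j}"
  have "inj_on (insert v) ?S"
    by (rule inj_onI) (auto simp: link_def)
  moreover have "insert v ` ?S = {A \<in> F. card A = Suc j \<and> v \<in> A}"
  proof (intro set_eqI iffI)
    fix B assume "B \<in> insert v ` ?S"
    then obtain A where A: "A \<in> link v F" "card A = j" "B = insert v A" by auto
    then have "finite A" using simplicial_complex_finite(2)[OF assms] link_subset[OF assms] by blast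
    then show "B \<in> {A \<in> F. card A = Suc j \<and> v \<in> A}" using A by (auto simp: link_def)
  next
    fix B assume B: "B \<in> {A \<in> F. card A = Suc j \<and> v \<in> A}"
    then have "B - {v} \<in> ?S" by (auto simp: link_def insert_absorb)
    moreover have "B = insert v (B - {v})" using B by blast
    ultimately show "B \<in> insert v ` ?S" by blast
  qed
  ultimately show ?thesis
    unfolding face_count_def using card_image[of "insert v" ?S] by simp
qed

text \<open>Double counting of pairs of a vertex and a face of size \<open>Suc j\<close> containing
  it.\<close>

lemma sum_face_count_link:
  assumes "simplicial_complex F"
  shows "(\<Sum>v\<in>\<Union>F. face_count j (link v F)) = Suc j * face_count (Suc j) F"
proof -
  let ?S = "{A \<in> F. card A = Suc j}"
  have fin: "finite (\<Union>F)" "finite F"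
    using assms simplicial_complex_finite[OF assms] by (auto simp: simplicial_complex_def)
  have "(\<Sum>v\<in>\<Union>F. face_count j (link v F)) = (\<Sum>v\<in>\<Union>F. card {A \<in> ?S. v \<in> A})"
    by (simp add: face_count_link[OF assms] conj_assoc)
  also have "\<dots> = (\<Sum>v\<in>\<Union>F. \<Sum>A | A \<in> ?S \<and> v \<in> A. 1)"
    by simp
  also have "\<dots> = (\<Sum>A\<in>?S. \<Sum>v | v \<in> \<Union>F \<and> v \<in> A. 1)"
    by (rule sum.swap_restrict) (use fin in auto)
  also have "\<dots> = (\<Sum>A\<in>?S. Suc j)"
  proof (rule sum.cong)
    fix A assume "A \<in> ?S"
    then have "{v. v \<in> \<Union>F \<and> v \<in> A} = A" "card A = Suc j" by auto
    then show "(\<Sum>v | v \<in> \<Union>F \<and> v \<in> A. 1) = Suc j" by simp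
  qed simp
  finally show ?thesis by (simp add: face_count_def mult.commute)
qed

lemma face_count_mono:
  assumes "F \<subseteq> F'" and "finite F'"
  shows "face_count j F \<le> face_count j F'"
  unfolding face_count_def by (rule card_mono) (use assms in auto)

text \<open>The case of consecutive sizes. The induction hypothesis is applied to every vertex link;
  combined with the trivial bound by the whole complex it becomes linear in the link's
  \<open>j\<close>-count, so that \<open>sum_face_count_link\<close> can sum it over all
  vertices.\<close>

lemma face_count_Suc_power_le:
  assumes "simplicial_complex F"
  shows "face_count (Suc j) F ^ j \<le> face_count j F ^ Suc j"
  using assms
proof (induction j arbitrary: F)
  case 0
  then have "{A \<in> F. card A = 0} = {{}}"
    using simplicial_complex_finite(2)[OF 0] by (auto simp: simplicial_complex_def)
  then show ?case by (simp add: face_count_def)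
next
  case (Suc j)
  note F = Suc.prems
  define K where "K = face_count (Suc j) F"
  \<comment> \<open>Multiplying \<open>x ^ j \<le> a ^ Suc j\<close> by \<open>x \<le> K\<close>
    gives \<open>x ^ Suc j \<le> K * a ^ Suc j\<close>; the root \<open>t\<close> turns this into
    \<open>x \<le> t * a\<close>.\<close>
  define t where "t = root (Suc j) (real K)"
  have t: "t \<ge> 0" "t ^ Suc j = real K" by (simp_all add: t_def del: power_Suc)
  have link_le: "real (face_count (Suc j) (link v F)) \<le> t * real (face_count j (link v F))"
    if v: "v \<in> \<Union>F" for v
  proof -
    define x a where "x = face_count (Suc j) (link v F)" and "a = face_count j (link v F)"
    have "x ^ j \<le> a ^ Suc j"
      unfolding x_def a_def by (rule Suc.IH[OF simplicial_complex_link[OF F v]])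
    moreover have "x \<le> K"
      unfolding x_def K_def
      by (rule face_count_mono[OF link_subset[OF F] simplicial_complex_finite(1)[OF F]])
    ultimately have "x ^ Suc j \<le> K * a ^ Suc j"
      unfolding power_Suc[of x] by (intro mult_mono) simp_all
    then have "real x ^ Suc j \<le> real K * real a ^ Suc j"
      by (metis of_nat_le_iff of_nat_mult of_nat_power)
    also have "\<dots> = (t * real a) ^ Suc j"
      using t(2) by (simp only: power_mult_distrib)
    finally show ?thesis
      unfolding x_def[symmetric] a_def[symmetric]
      by (rule power_le_imp_le_base) (simp add: t)
  qed
  have "real (Suc (Suc j)) * real (face_count (Suc (Suc j)) F)
      = (\<Sum>v\<in>\<Union>F. real (face_count (Suc j) (link v F)))"
    using sum_face_count_link[OF F, of "Suc j"] by (metis of_nat_mult of_nat_sum)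
  also have "\<dots> \<le> (\<Sum>v\<in>\<Union>F. t * real (face_count j (link v F)))"
    by (rule sum_mono) (rule link_le)
  also have "\<dots> = t * (real (Suc j) * real K)"
    using sum_face_count_link[OF F, of j]
    by (metis K_def of_nat_mult of_nat_sum sum_distrib_left)
  \<comment> \<open>Double counting yields the factor \<open>Suc j\<close> here but
    \<open>Suc (Suc j)\<close> on the left; enlarging the smaller factor lets both cancel.\<close>
  also have "\<dots> \<le> real (Suc (Suc j)) * (t * real K)"
    using t(1) by (simp add: algebra_simps)
  finally have "real (face_count (Suc (Suc j)) F) \<le> t * real K"
    by (simp only: mult_le_cancel_left_pos of_nat_0_less_iff zero_less_Suc)
  then have "real (face_count (Suc (Suc j)) F) ^ Suc j \<le> (t * real K) ^ Suc j"
    by (rule power_mono) simp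
  also have "\<dots> = real K ^ Suc (Suc j)"
    using t(2) by (simp only: power_mult_distrib) simp
  finally show ?case
    unfolding K_def by (metis of_nat_le_iff of_nat_power)
qed

lemma face_count_power_le:
  assumes "simplicial_complex F" and "1 \<le> i" and "i \<le> j"
  shows "face_count j F ^ i \<le> face_count i F ^ j"
  using assms(3)
proof (induction j rule: dec_induct)
  case base
  show ?case by simp
next
  case (step j)
  \<comment> \<open>Raising to the power \<open>j\<close> makes the consecutive inequality and the
    induction hypothesis composable. This power is removed at the end, where \<open>j\<close> is
    positive because \<open>1 \<le> i\<close> and \<open>i \<le> j\<close>.\<close>
  have "(face_count (Suc j) F ^ i) ^ j = (face_count (Suc j) F ^ j) ^ i"
    by (simp add: power_mult[symmetric] mult.commute)
  also have "\<dots> \<le> (face_count j F ^ Suc j) ^ i"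
    by (rule power_mono[OF face_count_Suc_power_le[OF assms(1)]]) simp
  also have "\<dots> = (face_count j F ^ i) ^ Suc j"
    by (metis power_mult mult.commute)
  also have "\<dots> \<le> (face_count i F ^ j) ^ Suc j"
    by (rule power_mono[OF step.IH]) simp
  also have "\<dots> = (face_count i F ^ Suc j) ^ j"
    by (metis power_mult mult.commute)
  finally show ?case
    using step.hyps(1) assms(2) by (meson le_trans less_le_trans not_less power_strict_mono zero_le less_numeral_extra(1))
qed

section \<open>Cliques as faces of a simplicial complex\<close>

definition cliques :: "'a pair_pre_digraph \<Rightarrow> 'a set set" where
  "cliques G = {A. A \<subseteq> pverts G \<and> (\<forall>u\<in>A. \<forall>v\<in>A. u \<noteq> v \<longrightarrow> (u, v) \<in> parcs G)}"

lemma simplicial_complex_cliques: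
  assumes "pair_graph G"
  shows "simplicial_complex (cliques G)"
proof -
  interpret pair_graph G by fact
  have "\<Union>(cliques G) \<subseteq> pverts G" by (auto simp: cliques_def)
  then have "finite (\<Union>(cliques G))" using pair_finite_verts by (rule finite_subset)
  then show ?thesis unfolding simplicial_complex_def cliques_def by blast
qed

text \<open>A complete subgraph is determined by its vertex set, so \<open>pverts\<close> maps the
  copies of the complete graph bijectively onto the cliques of the same size.\<close>

lemma clique_count_eq_face_count:
  assumes "pair_graph G"
  shows "clique_count i G = face_count i (cliques G)"
proof -
  interpret pair_graph G by fact
  let ?S = "{H :: 'a pair_pre_digraph. subgraph H G \<and> K\<^bsub>i\<^esub> H}"
  have inj: "inj_on pverts ?S"
  proof (rule inj_onI)
    fix H H' :: "'a pair_pre_digraph"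
    assume *: "H \<in> ?S" "H' \<in> ?S" "pverts H = pverts H'"
    have "K\<^bsub>i\<^esub> H" "K\<^bsub>i\<^esub> H'" using * by blast+
    then have "parcs H = parcs H'" by (simp add: complete_digraph_pair_def *(3))
    with *(3) show "H = H'" by simp
  qed
  have "pverts ` ?S = {A \<in> cliques G. card A = i}"
  proof (intro set_eqI iffI)
    fix A assume "A \<in> pverts ` ?S"
    then show "A \<in> {A \<in> cliques G. card A = i}"
      by (auto simp: complete_digraph_pair_def subgraph_def cliques_def)
  next
    fix A assume A: "A \<in> {A \<in> cliques G. card A = i}"
    define H :: "'a pair_pre_digraph"
      where "H = \<lparr>pverts = A, parcs = {(u, v). (u, v) \<in> A \<times> A \<and> u \<noteq> v}\<rparr>"
    have "finite A" using A pair_finite_verts by (auto simp: cliques_def intro: finite_subset)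
    then have "K\<^bsub>i\<^esub> H" using A by (auto simp: complete_digraph_pair_def H_def)
    moreover have "wf_digraph (with_proj H)" by (auto simp: H_def wf_digraph_def)
    then have "subgraph H G"
      using A wf_digraph by (auto simp: subgraph_def H_def compatible_def cliques_def)
    ultimately have "H \<in> ?S" by blast
    moreover have "A = pverts H" by (simp add: H_def)
    ultimately show "A \<in> pverts ` ?S" by (rule rev_image_eqI)
  qed
  then show ?thesis
    using card_image[OF inj] by (simp add: clique_count_def face_count_def)
qed

lemma clique_count_power_le:
  assumes "pair_graph G" and "1 \<le> i" and "i \<le> r"
  shows "clique_count r G ^ i \<le> clique_count i G ^ r"
  using face_count_power_le[OF simplicial_complex_cliques[OF assms(1)] assms(2,3)]
  by (simp add: clique_count_eq_face_count[OF assms(1)])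

lemma clique_count_1:
  assumes "pair_graph G"
  shows "clique_count 1 G = card (pverts G)"
proof -
  have "{A \<in> cliques G. card A = 1} = (\<lambda>v. {v}) ` pverts G"
    by (auto simp: cliques_def card_1_singleton_iff)
  then show ?thesis
    by (simp add: clique_count_eq_face_count[OF assms] face_count_def card_image)
qed

section \<open>Degrees and the deletion of low-degree vertices\<close>

definition nbrs :: "'a pair_pre_digraph \<Rightarrow> 'a \<Rightarrow> 'a set" where
  "nbrs G v = {w. (v, w) \<in> parcs G}"

definition induced_on :: "'a pair_pre_digraph \<Rightarrow> 'a set \<Rightarrow> 'a pair_pre_digraph" where
  "induced_on G W = \<lparr>pverts = W, parcs = parcs G \<inter> W \<times> W\<rparr>"

lemma finite_nbrs:
  assumes "pair_graph G"
  shows "finite (nbrs G v)"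
proof -
  interpret pair_graph G by fact
  have "nbrs G v \<subseteq> pverts G" using in_arcsD2 by (auto simp: nbrs_def)
  then show ?thesis using pair_finite_verts by (rule finite_subset)
qed

lemma pair_graph_induced_on:
  assumes "pair_graph G" and "W \<subseteq> pverts G"
  shows "pair_graph (induced_on G W)"
proof -
  interpret pair_graph G by fact
  have "finite W" using assms(2) pair_finite_verts by (rule finite_subset)
  then show ?thesis
    using pair_finite_arcs pair_no_loops pair_sym_arcs
    by unfold_locales (auto simp: induced_on_def symmetric_def sym_def)
qed

lemma subgraph_induced_on:
  assumes "pair_graph G" and "W \<subseteq> pverts G"
  shows "subgraph (induced_on G W) G"
proof -
  interpret pair_graph G by fact
  have "wf_digraph (with_proj (induced_on G W))"
    by (auto simp: induced_on_def wf_digraph_def)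
  then show ?thesis
    using assms(2) wf_digraph by (auto simp: subgraph_def induced_on_def compatible_def)
qed

text \<open>The degrees add up to the number of arcs, and the arcs with a given set of endpoints
  number at most two.\<close>

lemma sum_card_nbrs_le:
  assumes "pair_graph G"
  shows "(\<Sum>v\<in>pverts G. card (nbrs G v)) \<le> 2 * card (uedges G)"
proof -
  interpret pair_graph G by fact
  have "(SIGMA v:pverts G. nbrs G v) = parcs G"
    using in_arcsD1 by (auto simp: nbrs_def)
  then have sum_eq: "(\<Sum>v\<in>pverts G. card (nbrs G v)) = card (parcs G)"
    using pair_finite_verts finite_nbrs[OF assms] card_SigmaI[of "pverts G" "nbrs G"] by simp
  have cover: "parcs G \<subseteq> (\<Union>e\<in>uedges G. {p. {fst p, snd p} = e})"
    unfolding uedges_def by force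
  have fibre: "finite {p. {fst p, snd p} = e} \<and> card {p. {fst p, snd p} = e} \<le> 2"
    if "e \<in> uedges G" for e
  proof -
    obtain u v where "e = {u, v}" using \<open>e \<in> uedges G\<close> by (auto simp: uedges_def)
    then have sub: "{p. {fst p, snd p} = e} \<subseteq> {(u, v), (v, u)}"
      by (auto simp: doubleton_eq_iff)
    have "card {p. {fst p, snd p} = e} \<le> card {(u, v), (v, u)}"
      by (rule card_mono[OF _ sub]) simp
    also have "\<dots> \<le> 2"
      using card_length[of "[(u, v), (v, u)]"] by simp
    finally show ?thesis using finite_subset[OF sub] by simp
  qed
  have fin: "finite (uedges G)"
  proof -
    have "uedges G \<subseteq> (\<lambda>p. {fst p, snd p}) ` parcs G" by (force simp: uedges_def)
    then show ?thesis using pair_finite_arcs by (meson finite_imageI finite_subset)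
  qed
  have "card (parcs G) \<le> card (\<Union>e\<in>uedges G. {p. {fst p, snd p} = e})"
    by (rule card_mono[OF _ cover]) (use fin fibre in blast)
  also have "\<dots> \<le> (\<Sum>e\<in>uedges G. card {p. {fst p, snd p} = e})"
    by (rule card_UN_le[OF fin])
  also have "\<dots> \<le> (\<Sum>e\<in>uedges G. 2)"
    by (rule sum_mono) (use fibre in blast)
  finally show ?thesis
    by (simp add: sum_eq mult.commute)
qed

text \<open>Removing \<open>v\<close> from such a clique leaves a \<open>j\<close>-subset of its
  neighbourhood, and a binomial coefficient is at most the corresponding power.\<close>

lemma card_cliques_through_vertex_le:
  assumes "pair_graph G"
  shows "card {A \<in> cliques G. card A = Suc j \<and> v \<in> A} \<le> card (nbrs G v) ^ j"
proof -
  have "card {A \<in> cliques G. card A = Suc j \<and> v \<in> A} = face_count j (link v (cliques G))"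
    by (simp add: face_count_link[OF simplicial_complex_cliques[OF assms]])
  also have "\<dots> \<le> card {A. A \<subseteq> nbrs G v \<and> card A = j}"
    unfolding face_count_def
  proof (rule card_mono)
    show "finite {A. A \<subseteq> nbrs G v \<and> card A = j}"
      by (rule finite_subset[of _ "Pow (nbrs G v)"]) (auto simp: finite_nbrs[OF assms])
  qed (auto simp: link_def cliques_def nbrs_def)
  also have "\<dots> = card (nbrs G v) choose j"
    by (rule n_subsets[OF finite_nbrs[OF assms]])
  also have "\<dots> \<le> card (nbrs G v) ^ j"
    by (cases "j \<le> card (nbrs G v)") (simp_all add: binomial_le_pow binomial_eq_0)
  finally show ?thesis .
qed

text \<open>Each lost clique has a vertex outside \<open>W\<close> and is charged to it. Degrees are
  those in \<open>G\<close>, so all deletions happen in a single round. Writing the clique size as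
  \<open>Suc (Suc j)\<close> avoids the natural subtraction in the exponent of
  \<open>d\<close>.\<close>

lemma clique_count_delete_low_degree:
  fixes d :: real
  assumes G: "pair_graph G" and d: "d \<ge> 0"
  defines "W \<equiv> {v \<in> pverts G. real (card (nbrs G v)) \<ge> d}"
  shows "real (clique_count (Suc (Suc j)) G)
    \<le> real (clique_count (Suc (Suc j)) (induced_on G W)) + 2 * real (card (uedges G)) * d ^ j"
proof -
  interpret pair_graph G by fact
  let ?r = "Suc (Suc j)"
  let ?deg = "\<lambda>v. card (nbrs G v)"
  let ?L = "pverts G - W"
  let ?T = "\<lambda>v. {A \<in> cliques G. card A = ?r \<and> v \<in> A}"
  have W: "W \<subseteq> pverts G" by (auto simp: W_def)
  have fin: "finite (cliques G)" "finite ?L"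
    using simplicial_complex_finite(1)[OF simplicial_complex_cliques[OF G]] pair_finite_verts by auto
  have finW: "finite (cliques (induced_on G W))"
    by (rule simplicial_complex_finite(1)[OF simplicial_complex_cliques[OF pair_graph_induced_on[OF G W]]])
  have "{A \<in> cliques G. card A = ?r}
      \<subseteq> {A \<in> cliques (induced_on G W). card A = ?r} \<union> (\<Union>v\<in>?L. ?T v)"
    by (auto simp: cliques_def induced_on_def)
  then have "face_count ?r (cliques G)
      \<le> card ({A \<in> cliques (induced_on G W). card A = ?r} \<union> (\<Union>v\<in>?L. ?T v))"
    unfolding face_count_def by (rule card_mono[rotated]) (use fin finW in auto)
  also have "\<dots> \<le> face_count ?r (cliques (induced_on G W)) + card (\<Union>v\<in>?L. ?T v)"
    unfolding face_count_def by (rule card_Un_le)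
  also have "card (\<Union>v\<in>?L. ?T v) \<le> (\<Sum>v\<in>?L. card (?T v))"
    by (rule card_UN_le[OF fin(2)])
  also have "\<dots> \<le> (\<Sum>v\<in>?L. ?deg v ^ Suc j)"
    by (rule sum_mono) (rule card_cliques_through_vertex_le[OF G])
  finally have "clique_count ?r G \<le> clique_count ?r (induced_on G W) + (\<Sum>v\<in>?L. ?deg v ^ Suc j)"
    unfolding clique_count_eq_face_count[OF G]
      clique_count_eq_face_count[OF pair_graph_induced_on[OF G W]] by simp
  then have "real (clique_count ?r G)
      \<le> real (clique_count ?r (induced_on G W) + (\<Sum>v\<in>?L. ?deg v ^ Suc j))"
    by (rule of_nat_mono)
  also have "\<dots> = real (clique_count ?r (induced_on G W)) + (\<Sum>v\<in>?L. real (?deg v) ^ Suc j)"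
    by simp
  \<comment> \<open>One degree factor is kept for the degree sum; the other \<open>j\<close> factors
    are bounded by \<open>d\<close>.\<close>
  also have "(\<Sum>v\<in>?L. real (?deg v) ^ Suc j) \<le> (\<Sum>v\<in>?L. real (?deg v) * d ^ j)"
    by (rule sum_mono) (auto simp: W_def intro!: mult_left_mono power_mono)
  also have "\<dots> \<le> (\<Sum>v\<in>pverts G. real (?deg v) * d ^ j)"
    by (rule sum_mono2) (use pair_finite_verts d in auto)
  also have "\<dots> = real (\<Sum>v\<in>pverts G. ?deg v) * d ^ j"
    by (simp add: sum_distrib_right)
  also have "\<dots> \<le> real (2 * card (uedges G)) * d ^ j"
    using sum_card_nbrs_le[OF G] d by (intro mult_right_mono) (simp_all only: of_nat_le_iff zero_le_power)
  finally show ?thesis by simp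
qed

text \<open>Markov's inequality for the degrees.\<close>

lemma card_high_degree_le:
  fixes d :: real
  assumes G: "pair_graph G"
  shows "real (card {v \<in> pverts G. real (card (nbrs G v)) \<ge> d}) * d \<le> 2 * real (card (uedges G))"
    (is "real (card ?W) * d \<le> _")
proof -
  interpret pair_graph G by fact
  have "real (card ?W) * d = (\<Sum>v\<in>?W. d)" by simp
  also have "\<dots> \<le> (\<Sum>v\<in>?W. real (card (nbrs G v)))"
    by (rule sum_mono) simp
  also have "\<dots> \<le> (\<Sum>v\<in>pverts G. real (card (nbrs G v)))"
    by (rule sum_mono2) (use pair_finite_verts in auto)
  also have "\<dots> = real (\<Sum>v\<in>pverts G. card (nbrs G v))" by simp
  also have "\<dots> \<le> real (2 * card (uedges G))"
    using sum_card_nbrs_le[OF G] by (simp only: of_nat_le_iff)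
  finally show ?thesis by simp
qed

section \<open>Real exponents, choice of the parameters and the final estimates\<close>

lemma clique_count_ge_powr:
  fixes B x a :: real
  assumes G: "pair_graph G" and i: "1 \<le> i" "i \<le> r" and B: "B > 0" and x: "x > 0"
    and le: "B * x powr (a * real r) \<le> real (clique_count r G)"
  shows "B powr (real i / real r) * x powr (a * real i) \<le> real (clique_count i G)"
proof (rule power_le_imp_le_base)
  have r: "r > 0" using i by simp
  \<comment> \<open>Both sides are compared after raising to the power \<open>r\<close>, where the
    integer inequality \<open>clique_count_power_le\<close> applies.\<close>
  have "(B powr (real i / real r)) ^ r = B ^ i"
    using B r by (simp add: powr_power powr_realpow)
  moreover have "(x powr (a * real i)) ^ r = (x powr (a * real r)) ^ i"
    using x by (simp add: powr_power mult_ac)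
  ultimately have "(B powr (real i / real r) * x powr (a * real i)) ^ r = (B * x powr (a * real r)) ^ i"
    by (simp only: power_mult_distrib)
  also have "\<dots> \<le> real (clique_count r G) ^ i"
    by (rule power_mono[OF le]) (use B in simp)
  also have "\<dots> \<le> real (clique_count i G) ^ r"
    using clique_count_power_le[OF G i] by (metis of_nat_le_iff of_nat_power)
  finally have *: "(B powr (real i / real r) * x powr (a * real i)) ^ r \<le> real (clique_count i G) ^ r" .
  then show "(B powr (real i / real r) * x powr (a * real i)) ^ Suc (r - 1)
      \<le> real (clique_count i G) ^ Suc (r - 1)"
    using r by simp
qed simp

theorem theorem1p1:
  fixes C \<alpha> :: real and r :: nat
  assumes "C > 0" and "r \<ge> 3" and "\<alpha> \<in> {2 / real r <.. 1}"
  shows "\<exists>c :: nat \<Rightarrow> real. (\<forall>i\<in>{1..r}. c i > 0) \<and>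
    (\<forall>(G :: 'a pair_pre_digraph) m. pair_graph G \<and> m = card (uedges G) \<and>
        real (clique_count r G) \<ge> C * real m powr (\<alpha> * real r / 2) \<longrightarrow>
      (\<exists>(G\<^sub>0 :: 'a pair_pre_digraph) n\<^sub>0. pair_graph G\<^sub>0 \<and> subgraph G\<^sub>0 G \<and> n\<^sub>0 = card (pverts G\<^sub>0) \<and>
        real n\<^sub>0 \<ge> c 1 * real m powr (\<alpha> / 2) \<and>
        (\<forall>i\<in>{2..r}. real (clique_count i G\<^sub>0) \<ge>
          c i * real n\<^sub>0 powr (real i * (real r - 2) * \<alpha> / ((2 - \<alpha>) * real r - 2)))))"
proof -
  obtain j where r: "r = Suc (Suc j)" and j: "j \<ge> 1"
    using assms(2) by (intro that[of "r - 2"]) simp_all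
  define D where "D = (2 - \<alpha>) * real r - 2"
  \<comment> \<open>\<open>real i * \<beta>\<close> is the exponent of the order in the claimed
    bound on copies of the complete graph on \<open>i\<close> vertices.\<close>
  define \<beta> where "\<beta> = real j * \<alpha> / D"
  define t where "t = (\<alpha> * real r - 2) / (2 * real j)"
  \<comment> \<open>With \<open>\<epsilon> ^ j = C / 4\<close> the loss \<open>2 * m * d ^ j\<close>
    equals exactly half of the assumed lower bound.\<close>
  define \<epsilon> where "\<epsilon> = (C / 4) powr (1 / real j)"
  have \<alpha>: "\<alpha> > 0" "\<alpha> \<le> 1" "\<alpha> * real r > 2"
    using assms(2,3) by (auto simp: field_simps intro: less_trans[of _ "2 / real r"])
  \<comment> \<open>Since \<alpha> is at most 1, \<open>D\<close> is at least \<open>r - 2\<close>,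
    hence positive.\<close>
  have "\<alpha> * real r \<le> real r" using mult_right_mono[OF \<alpha>(2), of "real r"] by simp
  then have D: "D > 0" using j by (simp add: D_def r algebra_simps)
  have \<beta>: "\<beta> > 0" using \<alpha> j D by (simp add: \<beta>_def)
  \<comment> \<open>This identity explains the exponent in the theorem: the order is at most a
    constant times \<open>m powr (1 - t)\<close>, and the power \<beta> of that is
    \<open>m powr (\<alpha> / 2)\<close>.\<close>
  have t\<beta>: "(1 - t) * \<beta> = \<alpha> / 2"
  proof -
    have "(1 - t) * (2 * real j) = D"
      using j by (simp add: t_def D_def r field_simps)
    then have "1 - t = D / (2 * real j)" using j by (simp add: field_simps)
    then show ?thesis using j D by (simp add: \<beta>_def)
  qed
  have tj: "1 + t * real j = \<alpha> * real r / 2" using j by (simp add: t_def field_simps)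
  have \<epsilon>: "\<epsilon> > 0" "\<epsilon> ^ j = C / 4"
    using assms(1) j by (simp_all add: \<epsilon>_def powr_power)
  \<comment> \<open>The first factor comes from taking an \<open>r\<close>-th root. The second pays
    for replacing \<open>m\<close> by the order; for \<open>i = 1\<close> the bound stays in terms
    of \<open>m\<close>, so nothing is paid.\<close>
  define c :: "nat \<Rightarrow> real" where
    "c i = (C / 2) powr (real i / real r) * (if i = 1 then 1 else (\<epsilon> / 2) powr (real i * \<beta>))" for i
  show ?thesis
  proof (intro exI[of _ c] conjI ballI allI impI)
    fix i show "c i > 0" using assms(1) \<epsilon>(1) by (simp add: c_def)
  next
    fix G :: "'a pair_pre_digraph" and m
    assume "pair_graph G \<and> m = card (uedges G) \<and>
      real (clique_count r G) \<ge> C * real m powr (\<alpha> * real r / 2)"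
    then have G: "pair_graph G" and m: "m = card (uedges G)"
      and kr: "real (clique_count r G) \<ge> C * real m powr (\<alpha> * real r / 2)" by auto
    show "\<exists>(G\<^sub>0 :: 'a pair_pre_digraph) n\<^sub>0. pair_graph G\<^sub>0 \<and> subgraph G\<^sub>0 G \<and> n\<^sub>0 = card (pverts G\<^sub>0) \<and>
        real n\<^sub>0 \<ge> c 1 * real m powr (\<alpha> / 2) \<and>
        (\<forall>i\<in>{2..r}. real (clique_count i G\<^sub>0) \<ge>
          c i * real n\<^sub>0 powr (real i * (real r - 2) * \<alpha> / ((2 - \<alpha>) * real r - 2)))"
    proof (cases "m = 0")
      case True
      \<comment> \<open>The empty graph suffices, because \<open>0 powr x\<close> is 0 for every
        \<open>x\<close> and all required lower bounds vanish.\<close>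
      have "card (pverts (induced_on G {})) = 0" by (simp add: induced_on_def)
      with True show ?thesis
        using pair_graph_induced_on[OF G] subgraph_induced_on[OF G]
        by (intro exI[of _ "induced_on G {}"] exI[of _ "0::nat"]) simp
    next
      case False
      define d where "d = \<epsilon> * real m powr t"
      define W where "W = {v \<in> pverts G. real (card (nbrs G v)) \<ge> d}"
      define G\<^sub>0 where "G\<^sub>0 = induced_on G W"
      have d: "d > 0" using \<epsilon>(1) False by (simp add: d_def)
      have W: "W \<subseteq> pverts G" by (auto simp: W_def)
      have G\<^sub>0: "pair_graph G\<^sub>0" "subgraph G\<^sub>0 G" "pverts G\<^sub>0 = W"
        using pair_graph_induced_on[OF G W] subgraph_induced_on[OF G W]
        by (simp_all add: G\<^sub>0_def) (simp add: induced_on_def)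
      have "d ^ j = C / 4 * real m powr (t * real j)"
        using False \<epsilon>(2) by (simp add: d_def power_mult_distrib powr_power mult.commute)
      moreover have "real m powr (\<alpha> * real r / 2) = real m * real m powr (t * real j)"
        using False by (simp add: tj[symmetric] powr_add)
      ultimately have "2 * real m * d ^ j = C / 2 * real m powr (\<alpha> * real r / 2)"
        by simp
      moreover have "real (clique_count r G) \<le> real (clique_count r G\<^sub>0) + 2 * real m * d ^ j"
        using clique_count_delete_low_degree[OF G less_imp_le[OF d], of j]
        unfolding r m G\<^sub>0_def W_def .
      ultimately have kr0: "C / 2 * real m powr (\<alpha> / 2 * real r) \<le> real (clique_count r G\<^sub>0)"
        using kr by simp
      have ki: "(C / 2) powr (real i / real r) * real m powr (\<alpha> / 2 * real i) \<le> real (clique_count i G\<^sub>0)"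
        if "1 \<le> i" "i \<le> r" for i
        using clique_count_ge_powr[OF G\<^sub>0(1) that _ _ kr0] assms(1) False by simp
      have "real (card W) * d \<le> 2 * real m"
        using card_high_degree_le[OF G, of d] by (simp add: W_def m)
      then have "real (card W) \<le> 2 * real m / d" using d by (simp add: pos_le_divide_eq)
      also have "\<dots> = 2 / \<epsilon> * real m powr (1 - t)"
        using False by (simp add: d_def powr_diff)
      \<comment> \<open>The upper bound on the order is read as a lower bound on a power of
        \<open>m\<close>.\<close>
      finally have n0: "\<epsilon> / 2 * real (card W) \<le> real m powr (1 - t)"
        using \<epsilon>(1) by (simp add: pos_divide_le_eq pos_le_divide_eq mult.commute)
      \<comment> \<open>This is the bound \<open>ki\<close> for \<open>i = 1\<close>, as single
        vertices are the cliques of size one.\<close>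
      have "real (card W) \<ge> c 1 * real m powr (\<alpha> / 2)"
        using ki[of 1] assms(2) clique_count_1[OF G\<^sub>0(1)] by (simp add: c_def G\<^sub>0(3))
      moreover have "real (clique_count i G\<^sub>0) \<ge>
          c i * real (card W) powr (real i * (real r - 2) * \<alpha> / ((2 - \<alpha>) * real r - 2))"
        if i: "i \<in> {2..r}" for i
      proof -
        have "real i * (real r - 2) * \<alpha> / ((2 - \<alpha>) * real r - 2) = real i * \<beta>"
          unfolding D_def[symmetric] by (simp add: \<beta>_def r)
        moreover have "(\<epsilon> / 2) powr (real i * \<beta>) * real (card W) powr (real i * \<beta>)
            = (\<epsilon> / 2 * real (card W)) powr (real i * \<beta>)"
          using \<epsilon>(1) by (subst powr_mult) simp_all
        \<comment> \<open>The positive exponent preserves the direction of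
          \<open>n0\<close>.\<close>
        moreover have "\<dots> \<le> (real m powr (1 - t)) powr (real i * \<beta>)"
          using n0 \<epsilon>(1) \<beta> by (intro powr_mono2) simp_all
        moreover have "\<dots> = real m powr (\<alpha> / 2 * real i)"
          unfolding powr_powr t\<beta>[symmetric] by (simp only: mult_ac)
        ultimately have "c i * real (card W) powr (real i * (real r - 2) * \<alpha> / ((2 - \<alpha>) * real r - 2))
            \<le> (C / 2) powr (real i / real r) * real m powr (\<alpha> / 2 * real i)"
          using i by (simp add: c_def mult.assoc mult_left_mono)
        also have "\<dots> \<le> real (clique_count i G\<^sub>0)" using ki[of i] i by simp
        finally show ?thesis .
      qed
      ultimately show ?thesis
        using G\<^sub>0 by (intro exI[of _ G\<^sub>0] exI[of _ "card W"]) simp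
    qed
  qed
qed

end
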